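(* Let $\varphi$ be a random variable with probability distribution supported in $[0,1)$ (that is, $\varphi\in[0,1)$ almost surely), let $u_k=\mathbb{E}[\varphi^k]$ for $k\ge 1$, and let $m(r)=\sum_{k\ge 1}u_k r^k$ for $r\in[0,1)$. Let $\{a_k,\ k\ge 1\}$ be defined by $a_k=\mathbb{E}[A_k]$, where $A_1=\varphi$ and $A_{k+1}=(A_k-a_k)\varphi$ for $k\ge 1$. Then the sum $\sum_{k=1}^{\infty}a_k$ equals one if and only if $\lim_{r\to 1^-}m(r)=+\infty$, or equivalently if and only if $\sum_{k=1}^{\infty}u_k=+\infty$.
   Context: Equivalently, the $a_k$ are given by $a_1=u_1$ and $a_{k+1}=u_{k+1}-\sum_{r=1}^{k}a_r u_{k-r+1}$ for $k\ge 1$. The sum $\sum_{k\ge1} a_k$ is understood as the limit of partial sums. *)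

theory Defs
  imports "HOL-Probability.Probability"
begin

definition moment :: "'a measure \<Rightarrow> ('a \<Rightarrow> real) \<Rightarrow> nat \<Rightarrow> real" where
  "moment M \<phi> k = (\<integral>\<omega>. \<phi> \<omega> ^ k \<partial>M)"

text \<open>The series starts at exponent 1.\<close>

definition moment_gf :: "'a measure \<Rightarrow> ('a \<Rightarrow> real) \<Rightarrow> real \<Rightarrow> real" where
  "moment_gf M \<phi> r = (\<Sum>k. moment M \<phi> (Suc k) * r ^ Suc k)"

text \<open>The sequence is indexed from 1; the value at index 0 is a dummy that never enters the
  recursion.\<close>

fun A_seq :: "'a measure \<Rightarrow> ('a \<Rightarrow> real) \<Rightarrow> nat \<Rightarrow> 'a \<Rightarrow> real" where
  "A_seq M \<phi> 0 = (\<lambda>\<omega>. 0)"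
| "A_seq M \<phi> (Suc 0) = \<phi>"
| "A_seq M \<phi> (Suc (Suc k)) =
     (\<lambda>\<omega>. (A_seq M \<phi> (Suc k) \<omega> - (\<integral>\<omega>'. A_seq M \<phi> (Suc k) \<omega>' \<partial>M)) * \<phi> \<omega>)"

definition a_seq :: "'a measure \<Rightarrow> ('a \<Rightarrow> real) \<Rightarrow> nat \<Rightarrow> real" where
  "a_seq M \<phi> k = (\<integral>\<omega>. A_seq M \<phi> k \<omega> \<partial>M)"

end

theory Submission imports Defs begin

text \<open>
  The moments \<open>u\<close> form a decreasing log-convex sequence with \<open>u 0 = 1\<close>, and unfolding the recursion
  for \<open>A\<close> yields the renewal equation \<open>u n = (\<Sum>j\<le>n. a j * u (n - j))\<close> for \<open>n > 0\<close>. By Kaluza's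
  argument, increasing ratios \<open>u (n + 1) / u n\<close> force \<open>a n \<ge> 0\<close>; monotonicity of \<open>u\<close> then gives
  \<open>\<Sum>a \<le> 1\<close>. Summing the renewal equation up to \<open>N\<close> gives \<open>U N - 1 \<le> (\<Sum>j\<le>N. a j) * U N\<close> for the
  partial sums \<open>U\<close> of \<open>u\<close>, so \<open>\<Sum>a = 1\<close> if \<open>U\<close> diverges; if it converges to \<open>s\<close>, the Cauchy product
  gives \<open>s = 1 + s * \<Sum>a\<close>, which excludes \<open>\<Sum>a = 1\<close>.
\<close>

section \<open>Nonnegative series\<close>

lemma filterlim_sum_at_top_iff_not_summable:
  fixes v :: "nat \<Rightarrow> real"
  assumes nonneg: "\<And>k. 0 \<le> v k"
  shows "filterlim (\<lambda>n. \<Sum>k<n. v k) at_top sequentially \<longleftrightarrow> \<not> summable v"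
proof
  assume top: "filterlim (\<lambda>n. \<Sum>k<n. v k) at_top sequentially"
  show "\<not> summable v"
  proof
    assume "summable v"
    then have "(\<lambda>n. \<Sum>k<n. v k) \<longlonglongrightarrow> suminf v"
      by (rule summable_LIMSEQ)
    with top show False
      using not_tendsto_and_filterlim_at_infinity[OF sequentially_bot _ filterlim_at_top_imp_at_infinity]
      by blast
  qed
next
  assume diverges: "\<not> summable v"
  show "filterlim (\<lambda>n. \<Sum>k<n. v k) at_top sequentially"
    unfolding filterlim_at_top
  proof
    fix Z :: real
    obtain N where N: "Z < (\<Sum>k<N. v k)"
      using diverges nonneg summableI_nonneg_bounded[of v Z] by (meson not_le)
    have "Z \<le> (\<Sum>k<n. v k)" if "n \<ge> N" for n
    proof -
      have "(\<Sum>k<N. v k) \<le> (\<Sum>k<n. v k)"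
        using that nonneg by (intro sum_mono2) auto
      with N show ?thesis by simp
    qed
    then show "\<forall>\<^sub>F n in sequentially. Z \<le> (\<Sum>k<n. v k)"
      by (auto simp: eventually_sequentially)
  qed
qed

text \<open>For 0 < r < 1 the series lies below \<open>suminf v\<close> when \<open>v\<close> is
  summable. Otherwise some finite partial sum exceeds any given bound, and by continuity it still
  does so for r close to 1.\<close>

lemma filterlim_power_series_at_top_iff_not_summable:
  fixes v :: "nat \<Rightarrow> real"
  assumes nonneg: "\<And>k. 0 \<le> v k" and le_1: "\<And>k. v k \<le> 1"
  shows "filterlim (\<lambda>r. \<Sum>k. v k * r ^ Suc k) at_top (at_left 1) \<longleftrightarrow> \<not> summable v"
proof
  assume top: "filterlim (\<lambda>r. \<Sum>k. v k * r ^ Suc k) at_top (at_left 1)"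
  show "\<not> summable v"
  proof
    assume v: "summable v"
    have "\<forall>\<^sub>F r in at_left 1. suminf v + 1 \<le> (\<Sum>k. v k * r ^ Suc k)"
      using top by (simp add: filterlim_at_top)
    moreover have "\<forall>\<^sub>F r in at_left (1::real). r \<in> {0<..<1}"
      by (rule eventually_at_left_real) simp
    ultimately have "\<forall>\<^sub>F r in at_left (1::real). False"
    proof eventually_elim
      case (elim r)
      have le: "v k * r ^ Suc k \<le> v k" for k
        using elim nonneg[of k] power_le_one[of r "Suc k"] by (intro mult_left_le) auto
      have "summable (\<lambda>k. v k * r ^ Suc k)"
        using le elim nonneg by (intro summable_comparison_test'[OF v, of 0]) auto
      then have "(\<Sum>k. v k * r ^ Suc k) \<le> suminf v"
        using le v by (intro suminf_le)
      with elim show False by simp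
    qed
    then show False by simp
  qed
next
  assume diverges: "\<not> summable v"
  show "filterlim (\<lambda>r. \<Sum>k. v k * r ^ Suc k) at_top (at_left 1)"
    unfolding filterlim_at_top
  proof
    fix Z :: real
    obtain N where N: "Z < (\<Sum>k<N. v k)"
      using diverges nonneg summableI_nonneg_bounded[of v Z] by (meson not_le)
    have "((\<lambda>r. \<Sum>k<N. v k * r ^ Suc k) \<longlongrightarrow> (\<Sum>k<N. v k * 1 ^ Suc k)) (at_left 1)"
      by (intro tendsto_intros)
    then have "\<forall>\<^sub>F r in at_left 1. Z < (\<Sum>k<N. v k * r ^ Suc k)"
      using N by (intro order_tendstoD) auto
    moreover have "\<forall>\<^sub>F r in at_left (1::real). r \<in> {0<..<1}"
      by (rule eventually_at_left_real) simp
    ultimately show "\<forall>\<^sub>F r in at_left 1. Z \<le> (\<Sum>k. v k * r ^ Suc k)"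
    proof eventually_elim
      case (elim r)
      \<comment> \<open>Comparing the infinite sum with its partial sums requires convergence;
        \<open>le_1\<close> supplies it through the geometric series.\<close>
      have "summable (\<lambda>k. r ^ Suc k)"
        using elim by (simp add: summable_mult summable_geometric)
      then have "summable (\<lambda>k. v k * r ^ Suc k)"
      proof (rule summable_comparison_test')
        show "norm (v k * r ^ Suc k) \<le> r ^ Suc k" if "k \<ge> 0" for k
          using elim nonneg[of k] le_1[of k] by (simp add: abs_mult mult_left_le_one_le)
      qed
      then have "(\<Sum>k<N. v k * r ^ Suc k) \<le> (\<Sum>k. v k * r ^ Suc k)"
        using elim nonneg by (intro sum_le_suminf) auto
      with elim show ?case by simp
    qed
  qed
qed

section \<open>Log-convex renewal sequences\<close>

text \<open>The values at index 0 turn the recursion into a full convolution u = delta_0 + a * u, so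
  that Cauchy products apply without index shifts.\<close>

locale log_convex_renewal =
  fixes u a :: "nat \<Rightarrow> real"
  assumes u_nonneg: "0 \<le> u n"
    and u_Suc_le: "u (Suc n) \<le> u n"
    and log_convex: "(u (Suc n))\<^sup>2 \<le> u n * u (Suc (Suc n))"
    and u_0: "u 0 = 1"
    and a_0: "a 0 = 0"
    and renewal: "0 < n \<Longrightarrow> u n = (\<Sum>j\<le>n. a j * u (n - j))"
begin

lemma u_antimono: "m \<le> n \<Longrightarrow> u n \<le> u m"
  by (rule lift_Suc_antimono_le[of u, OF u_Suc_le])

text \<open>Log-convexity propagates positivity: if \<open>u n\<close> and \<open>u (Suc n)\<close>
  are positive, the square forces \<open>u (Suc (Suc n))\<close> to be positive too. If
  \<open>u 1\<close> vanishes, monotonicity kills all later terms.\<close>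

lemma u_pos_or_trivial: "(\<forall>n. 0 < u n) \<or> (\<forall>n>0. u n = 0)"
proof (cases "u 1 = 0")
  case True
  then have "u n = 0" if "n > 0" for n
    using that u_antimono[of 1 n] u_nonneg[of n] by simp
  then show ?thesis by blast
next
  case False
  have "0 < u n \<and> 0 < u (Suc n)" for n
  proof (induction n)
    case 0
    then show ?case using False u_0 u_nonneg[of 1] by simp
  next
    case (Suc n)
    then have "0 < u n * u (Suc (Suc n))"
      using log_convex[of n] by (meson less_le_trans zero_less_power)
    then show ?case using Suc by (simp add: zero_less_mult_iff)
  qed
  then show ?thesis by blast
qed

lemma ratio_mono:
  assumes pos: "\<And>n. 0 < u n" and "m \<le> n"
  shows "u (Suc m) * u n \<le> u m * u (Suc n)"
proof -
  have "u (Suc n) / u n \<le> u (Suc (Suc n)) / u (Suc n)" for n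
    using log_convex[of n] pos by (simp add: divide_simps power2_eq_square mult.commute)
  then have "u (Suc m) / u m \<le> u (Suc n) / u n"
    using \<open>m \<le> n\<close> by (rule lift_Suc_mono_le)
  then show ?thesis
    using pos[of m] pos[of n] by (simp add: divide_simps mult.commute)
qed

text \<open>By strong induction: in the renewal equation at m + 1, multiply the terms with j \<le> m
  by \<open>u m\<close>. As these \<open>a j\<close> are nonnegative, \<open>ratio_mono\<close>
  replaces \<open>u (Suc (m - j)) * u m\<close> by \<open>u (m - j) * u (Suc m)\<close>, and the
  renewal equation at m sums the result to \<open>u m * u (Suc m)\<close>. What is left for
  \<open>a (Suc m)\<close> is nonnegative.\<close>

lemma a_nonneg: "0 \<le> a n"
proof (cases "\<forall>n. 0 < u n")
  case False
  then have zero: "u n = 0" if "n > 0" for n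
    using u_pos_or_trivial that by blast
  show ?thesis
  proof (cases "n = 0")
    case False
    have "u n = (\<Sum>j\<le>n. if j = n then a n else 0)"
      unfolding renewal[OF False[unfolded neq0_conv]] using zero u_0
      by (intro sum.cong) auto
    then show ?thesis using u_nonneg[of n] by simp
  qed (simp add: a_0)
next
  case True
  show ?thesis
  proof (induction n rule: less_induct)
    case (less n)
    show ?case
    proof (cases n rule: nat.exhaust)
      case (Suc m)
      have "u m * (\<Sum>j\<le>m. a j * u (Suc m - j)) \<le> u m * u (Suc m)"
      \<comment> \<open>The renewal equation fails at index 0; there the sum is the single term
        \<open>a 0 * u 1\<close>, which is 0.\<close>
      proof (cases "m = 0")
        case False
        have "u m * (\<Sum>j\<le>m. a j * u (Suc m - j)) = (\<Sum>j\<le>m. a j * (u (Suc (m - j)) * u m))"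
          by (simp add: sum_distrib_left mult_ac Suc_diff_le cong: sum.cong_simp)
        also have "\<dots> \<le> (\<Sum>j\<le>m. a j * (u (m - j) * u (Suc m)))"
          using True less Suc by (intro sum_mono mult_left_mono ratio_mono) auto
        also have "\<dots> = u m * u (Suc m)"
          using renewal[of m] False by (simp add: sum_distrib_left mult_ac)
        finally show ?thesis .
      qed (use True u_nonneg in \<open>simp add: a_0\<close>)
      then have "(\<Sum>j\<le>m. a j * u (Suc m - j)) \<le> u (Suc m)"
        using True by simp
      then show ?thesis
        using renewal[of "Suc m"] Suc by (simp add: u_0)
    qed (simp add: a_0)
  qed
qed

text \<open>In the renewal equation each \<open>u (n - j)\<close> is at least \<open>u n\<close>,
  which then cancels.\<close>

lemma sum_a_le_1: "(\<Sum>j\<le>n. a j) \<le> 1" if pos: "0 < u n"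
proof (cases "n = 0")
  case False
  have "(\<Sum>j\<le>n. a j) * u n \<le> (\<Sum>j\<le>n. a j * u (n - j))"
    unfolding sum_distrib_right using a_nonneg u_antimono
    by (intro sum_mono mult_left_mono) auto
  also have "\<dots> = 1 * u n"
    using renewal[of n] False by simp
  finally show ?thesis using pos by (simp only: mult_le_cancel_right_pos)
qed (simp add: a_0)

text \<open>The summed convolution runs over the triangle i + j \<le> N; nonnegativity allows
  enlarging it to a square, where the sum factors. The 1 is the defect of the renewal equation at
  index 0.\<close>

lemma sum_u_le: "(\<Sum>n\<le>N. u n) - 1 \<le> (\<Sum>j\<le>N. a j) * (\<Sum>n\<le>N. u n)"
proof -
  have "(\<Sum>j\<le>n. a j * u (n - j)) = u n - (if n = 0 then 1 else 0)" for n
    by (cases "n = 0") (simp_all add: renewal[symmetric] u_0 a_0)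
  then have "(\<Sum>n\<le>N. u n) - 1 = (\<Sum>n\<le>N. \<Sum>j\<le>n. a j * u (n - j))"
    by (simp add: sum_subtractf)
  also have "\<dots> = (\<Sum>(i, j)\<in>{(i, j). i + j \<le> N}. a i * u j)"
    by (rule sum.triangle_reindex_eq[symmetric])
  also have "\<dots> \<le> (\<Sum>(i, j)\<in>{..N} \<times> {..N}. a i * u j)"
    using a_nonneg u_nonneg by (intro sum_mono2) auto
  also have "\<dots> = (\<Sum>j\<le>N. a j) * (\<Sum>n\<le>N. u n)"
    by (simp add: sum_product sum.cartesian_product)
  finally show ?thesis .
qed

theorem a_sums_1_iff: "a sums 1 \<longleftrightarrow> \<not> summable u"
proof
  assume a: "a sums 1"
  show "\<not> summable u"
  proof
    assume u: "summable u"
    have "(\<lambda>n. \<Sum>j\<le>n. a j * u (n - j)) sums (suminf a * suminf u)"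
      using a u a_nonneg u_nonneg by (intro Cauchy_product_sums) (auto simp: sums_iff)
    \<comment> \<open>The term at index 0 is \<open>a 0 * u 0 = 0\<close>, so dropping it keeps the
      sum. The remaining terms are \<open>u (Suc n)\<close>, and restoring \<open>u 0 = 1\<close>
      yields s = s + 1.\<close>
    then have "(\<lambda>n. \<Sum>j\<le>Suc n. a j * u (Suc n - j)) sums suminf u"
      using a by (subst sums_Suc_iff) (simp add: sums_iff a_0)
    then have "(\<lambda>n. u (Suc n)) sums suminf u"
      by (subst renewal) auto
    then have "u sums (suminf u + 1)"
      by (subst (asm) sums_Suc_iff) (simp add: u_0)
    then show False by (simp add: sums_iff)
  qed
next
  assume diverges: "\<not> summable u"
  have pos: "0 < u n" for n
  proof (rule ccontr)
    assume "\<not> 0 < u n"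
    then have "\<forall>n>0. u n = 0" using u_pos_or_trivial by blast
    then have "summable u" by (intro summable_finite[of "{0}"]) auto
    with diverges show False ..
  qed
  have "filterlim (\<lambda>N. \<Sum>n<Suc N. u n) at_top sequentially"
    unfolding filterlim_sequentially_Suc[of "\<lambda>N. \<Sum>n<N. u n"]
    using diverges u_nonneg by (simp add: filterlim_sum_at_top_iff_not_summable)
  then have top: "filterlim (\<lambda>N. \<Sum>n\<le>N. u n) at_top sequentially"
    by (simp only: lessThan_Suc_atMost)
  have U_pos: "0 < (\<Sum>n\<le>N. u n)" for N
    using pos by (intro sum_pos) auto
  \<comment> \<open>This is \<open>sum_u_le\<close> divided by the partial sum of \<open>u\<close>;
    it squeezes the partial sums of \<open>a\<close> against the upper bound 1.\<close>
  have "1 - inverse (\<Sum>n\<le>N. u n) \<le> (\<Sum>j\<le>N. a j)" for N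
    using sum_u_le[of N] U_pos[of N] by (simp add: field_simps)
  moreover have "(\<lambda>N. 1 - inverse (\<Sum>n\<le>N. u n)) \<longlonglongrightarrow> 1 - 0"
    by (intro tendsto_intros tendsto_inverse_0_at_top top)
  ultimately have "(\<lambda>N. \<Sum>j\<le>N. a j) \<longlonglongrightarrow> 1"
    using sum_a_le_1[OF pos]
    by (rule_tac real_tendsto_sandwich[where f = "\<lambda>N. 1 - inverse (\<Sum>n\<le>N. u n)" and h = "\<lambda>_. 1"])
      auto
  then show "a sums 1" by (simp add: sums_def_le)
qed

end

section \<open>Moments of a random variable in the unit interval\<close>

context
  fixes M :: "'a measure" and \<phi> :: "'a \<Rightarrow> real"
  assumes prob: "prob_space M"
    and meas [measurable]: "\<phi> \<in> borel_measurable M"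
    and unit: "AE \<omega> in M. \<phi> \<omega> \<in> {0..<1}"
begin

interpretation prob_space M by (rule prob)

lemma integrable_power: "integrable M (\<lambda>\<omega>. \<phi> \<omega> ^ k)"
proof (rule integrable_const_bound[where B = 1])
  show "AE \<omega> in M. norm (\<phi> \<omega> ^ k) \<le> 1"
    using unit by eventually_elim (auto simp: power_le_one)
qed measurable

text \<open>Each step multiplies by \<phi> and subtracts one new multiple of \<phi>. The term j = 0
  vanishes because the dummy \<open>A_seq M \<phi> 0\<close> is zero.\<close>

lemma A_seq_Suc:
  "A_seq M \<phi> (Suc k) \<omega> = \<phi> \<omega> ^ Suc k - (\<Sum>j\<le>k. a_seq M \<phi> j * \<phi> \<omega> ^ (Suc k - j))"
proof (induction k)
  case 0
  then show ?case by (simp add: a_seq_def)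
next
  case (Suc k)
  have "A_seq M \<phi> (Suc (Suc k)) \<omega> = (A_seq M \<phi> (Suc k) \<omega> - a_seq M \<phi> (Suc k)) * \<phi> \<omega>"
    by (simp add: a_seq_def)
  also have "\<dots> = \<phi> \<omega> ^ Suc (Suc k) - (\<Sum>j\<le>k. a_seq M \<phi> j * (\<phi> \<omega> * \<phi> \<omega> ^ (Suc k - j)))
                   - a_seq M \<phi> (Suc k) * \<phi> \<omega>"
    unfolding Suc by (simp add: algebra_simps sum_distrib_left)
  also have "(\<Sum>j\<le>k. a_seq M \<phi> j * (\<phi> \<omega> * \<phi> \<omega> ^ (Suc k - j)))
               = (\<Sum>j\<le>k. a_seq M \<phi> j * \<phi> \<omega> ^ (Suc (Suc k) - j))"
    by (intro sum.cong) (auto simp: Suc_diff_le)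
  finally show ?case by simp
qed

lemma moment_log_convex_renewal: "log_convex_renewal (moment M \<phi>) (a_seq M \<phi>)"
proof
  show nonneg: "0 \<le> moment M \<phi> n" for n
    unfolding moment_def using unit by (intro integral_nonneg_AE) (auto elim: eventually_mono)
  show dec: "moment M \<phi> (Suc n) \<le> moment M \<phi> n" for n
    unfolding moment_def
  proof (intro integral_mono_AE integrable_power)
    show "AE \<omega> in M. \<phi> \<omega> ^ Suc n \<le> \<phi> \<omega> ^ n"
      using unit by eventually_elim (auto intro: mult_left_le_one_le)
  qed
  show "moment M \<phi> 0 = 1"
    by (simp add: moment_def prob_space)
  show "a_seq M \<phi> 0 = 0"
    by (simp add: a_seq_def)
  show "(moment M \<phi> (Suc n))\<^sup>2 \<le> moment M \<phi> n * moment M \<phi> (Suc (Suc n))" for n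
  proof (cases "moment M \<phi> n = 0")
    case True
    then show ?thesis using dec[of n] nonneg[of "Suc n"] by simp
  next
    case False
    \<comment> \<open>Cauchy-Schwarz with weight \<open>\<phi> \<omega> ^ n\<close>: this
      \<open>t\<close> minimizes the nonnegative quadratic integrated below, and its minimum, times
      \<open>moment M \<phi> n\<close>, is the desired difference.\<close>
    define t where "t = moment M \<phi> (Suc n) / moment M \<phi> n"
    have "0 \<le> (\<integral>\<omega>. \<phi> \<omega> ^ n * (\<phi> \<omega> - t)\<^sup>2 \<partial>M)"
      using unit by (intro integral_nonneg_AE) (auto elim: eventually_mono)
    also have "\<dots> = (\<integral>\<omega>. \<phi> \<omega> ^ Suc (Suc n) - 2 * t * \<phi> \<omega> ^ Suc n + t\<^sup>2 * \<phi> \<omega> ^ n \<partial>M)"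
      by (simp add: power2_eq_square algebra_simps)
    also have "\<dots> = moment M \<phi> (Suc (Suc n)) - 2 * t * moment M \<phi> (Suc n) + t\<^sup>2 * moment M \<phi> n"
      unfolding moment_def
      by (simp add: integrable_power del: power_Suc)
    finally have "0 \<le> (moment M \<phi> (Suc (Suc n)) - 2 * t * moment M \<phi> (Suc n) + t\<^sup>2 * moment M \<phi> n)
                       * moment M \<phi> n"
      using nonneg[of n] by simp
    also have "\<dots> = moment M \<phi> n * moment M \<phi> (Suc (Suc n)) - (moment M \<phi> (Suc n))\<^sup>2"
      using False by (simp add: t_def field_simps power2_eq_square)
    finally show ?thesis by simp
  qed
  show "moment M \<phi> n = (\<Sum>j\<le>n. a_seq M \<phi> j * moment M \<phi> (n - j))" if "0 < n" for n
  proof -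
    obtain k where n: "n = Suc k" using \<open>0 < n\<close> by (cases n) auto
    \<comment> \<open>Integrating the closed form gives the renewal equation once
      \<open>a_seq M \<phi> (Suc k)\<close> is read as the missing term j = n, whose factor is the
      moment of order 0, namely 1.\<close>
    have "a_seq M \<phi> (Suc k) = moment M \<phi> (Suc k) - (\<Sum>j\<le>k. a_seq M \<phi> j * moment M \<phi> (Suc k - j))"
      unfolding a_seq_def[of M \<phi> "Suc k"] A_seq_Suc moment_def
      by (simp add: integrable_power del: power_Suc)
    then show ?thesis by (simp add: n moment_def prob_space)
  qed
qed

end

theorem proposition3:
  fixes M :: "'a measure" and \<phi> :: "'a \<Rightarrow> real"
  assumes "prob_space M"
    and "\<phi> \<in> borel_measurable M"
    and "AE \<omega> in M. \<phi> \<omega> \<in> {0..<1}"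
  shows "((\<lambda>k. a_seq M \<phi> (Suc k)) sums 1 \<longleftrightarrow>
            filterlim (moment_gf M \<phi>) at_top (at_left 1)) \<and>
         ((\<lambda>k. a_seq M \<phi> (Suc k)) sums 1 \<longleftrightarrow>
            filterlim (\<lambda>n. \<Sum>k=1..n. moment M \<phi> k) at_top sequentially)"
proof -
  interpret log_convex_renewal "moment M \<phi>" "a_seq M \<phi>"
    using assms by (rule moment_log_convex_renewal)
  have le_1: "moment M \<phi> n \<le> 1" for n
    using u_antimono[of 0 n] by (simp add: u_0)
  have "(\<lambda>k. a_seq M \<phi> (Suc k)) sums 1 \<longleftrightarrow> \<not> summable (\<lambda>k. moment M \<phi> (Suc k))"
    using a_sums_1_iff by (simp add: sums_Suc_iff summable_Suc_iff a_0)
  moreover have "filterlim (moment_gf M \<phi>) at_top (at_left 1)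
                   \<longleftrightarrow> \<not> summable (\<lambda>k. moment M \<phi> (Suc k))"
    unfolding moment_gf_def[abs_def] using u_nonneg le_1
    by (rule filterlim_power_series_at_top_iff_not_summable)
  moreover have "filterlim (\<lambda>n. \<Sum>k=1..n. moment M \<phi> k) at_top sequentially
                   \<longleftrightarrow> \<not> summable (\<lambda>k. moment M \<phi> (Suc k))"
    using filterlim_sum_at_top_iff_not_summable[OF u_nonneg[of "Suc _"]]
    by (simp add: sum.atLeast1_atMost_eq)
  ultimately show ?thesis by blast
qed

end
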